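(* Let $n\ge1$, $X=\{1,\ldots,n\}$, and let $S$ be the vertex set of a permutograph on $S_n$. A function $F:S\to X$ is a discrete piecewise linear function if and only if it satisfies the separation property.
   Context: A permutation $\alpha$ of $X$ is written $\alpha=(x_1\cdots x_n)$ with $x_k=k\alpha$ (permutations act on the right and are composed left to right, so $x(\alpha\beta)=(x\alpha)\beta$). It defines the linear order $<_\alpha$ on $X$: $x_i<_\alpha x_j\iff i<j$; $\le_\alpha,\ge_\alpha$ accordingly. A pair $\{x,y\}\subseteq X$ is an inversion for $\{\alpha,\beta\}$ if $x,y$ appear in reverse order in $\alpha$ and $\beta$; the distance $d(\alpha,\beta)$ is the number of inversions. An ordered partition of $(X,<)$ is a partition $\pi=(X_1,\ldots,X_m)$ into nonempty sets such that $x\in X_i$, $y\in X_j$, $i<j$ imply $x<y$; it is trivial if it is $(\{1\},\ldots,\{n\})$. For a nontrivial ordered partition $\pi$, $\tau_\pi$ is the permutation reversing the order of the elements within each block $X_i$. Permutations $\alpha,\beta$ are $\pi$-adjacent if $\alpha\beta^{-1}=\tau_\pi$ for a nontrivial ordered partition $\pi$, and adjacent if they are $\pi$-adjacent for some such $\pi$. The big permutograph $\Upsilon_n$ is the graph on $S_n$ whose edges are the adjacent pairs, each edge $\alpha\beta$ having weight $d(\alpha,\beta)$. A permutograph on $S_n$ is an isometric weighted subgraph of $\Upsilon_n$, i.e. a subgraph such that for any two of its vertices $\alpha,\beta$ the minimum total weight of a path between them inside the subgraph equals their weighted path distance in $\Upsilon_n$ (which equals $d(\alpha,\beta)$). For a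 set $Y\subseteq X$, $Y\alpha=\{y\alpha:y\in Y\}$. A function $F:S\to X$ is a discrete piecewise linear function (DPL-function) if for any two $\pi$-adjacent permutations $\alpha,\beta\in S$ with $\pi=(X_1,\ldots,X_m)$ there is $1\le i\le m$ with $F(\alpha)\in X_i\alpha$ and $F(\beta)\in X_i\beta$. $F$ satisfies the separation property if for any $\alpha,\beta\in S$ there is $u\in X$ with $u\le_\alpha F(\alpha)$ and $u\ge_\beta F(\beta)$. *)

theory Defs
  imports
    "HOL-Combinatorics.Permutations"
    "HOL-Library.Disjoint_Sets"
    "Graph_Theory.Graph_Theory"
begin

text \<open>
  \<open>S\<^sub>n\<close> consists of the functions \<open>\<alpha>\<close> with \<open>\<alpha> permutes {1..n}\<close>; the right action \<open>k\<alpha>\<close> is \<open>\<alpha> k\<close>,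
  and the left-to-right product is \<open>x(\<alpha>\<beta>) = \<beta> (\<alpha> x)\<close>.
\<close>

definition perm_mult :: "(nat \<Rightarrow> nat) \<Rightarrow> (nat \<Rightarrow> nat) \<Rightarrow> nat \<Rightarrow> nat" (infixl \<open>\<cdot>\<^sub>r\<close> 70)
  where "\<alpha> \<cdot>\<^sub>r \<beta> = \<beta> \<circ> \<alpha>"

text \<open>With \<open>x\<^sub>k = \<alpha> k\<close>, the position of \<open>x\<close> in the word \<open>(x\<^sub>1 \<dots> x\<^sub>n)\<close> is \<open>inv \<alpha> x\<close>.\<close>

definition perm_less :: "(nat \<Rightarrow> nat) \<Rightarrow> nat \<Rightarrow> nat \<Rightarrow> bool"
  where "perm_less \<alpha> x y \<longleftrightarrow> inv \<alpha> x < inv \<alpha> y"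

definition perm_le :: "(nat \<Rightarrow> nat) \<Rightarrow> nat \<Rightarrow> nat \<Rightarrow> bool"
  where "perm_le \<alpha> x y \<longleftrightarrow> inv \<alpha> x \<le> inv \<alpha> y"

definition inversions :: "nat \<Rightarrow> (nat \<Rightarrow> nat) \<Rightarrow> (nat \<Rightarrow> nat) \<Rightarrow> nat set set"
  where "inversions n \<alpha> \<beta> =
    {{x, y} | x y. x \<in> {1..n} \<and> y \<in> {1..n} \<and> perm_less \<alpha> x y \<and> perm_less \<beta> y x}"

definition perm_dist :: "nat \<Rightarrow> (nat \<Rightarrow> nat) \<Rightarrow> (nat \<Rightarrow> nat) \<Rightarrow> nat"
  where "perm_dist n \<alpha> \<beta> = card (inversions n \<alpha> \<beta>)"

definition ordered_partition :: "nat \<Rightarrow> nat set list \<Rightarrow> bool"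
  where "ordered_partition n \<pi> \<longleftrightarrow>
    partition_on {1..n} (set \<pi>) \<and> sorted_wrt (\<lambda>A B. \<forall>x\<in>A. \<forall>y\<in>B. x < y) \<pi>"

definition trivial_partition :: "nat \<Rightarrow> nat set list"
  where "trivial_partition n = map (\<lambda>k. {k}) [1..<Suc n]"

definition nontrivial_ordered_partition :: "nat \<Rightarrow> nat set list \<Rightarrow> bool"
  where "nontrivial_ordered_partition n \<pi> \<longleftrightarrow> ordered_partition n \<pi> \<and> \<pi> \<noteq> trivial_partition n"

definition reverses_blocks :: "nat \<Rightarrow> nat set list \<Rightarrow> (nat \<Rightarrow> nat) \<Rightarrow> bool"
  where "reverses_blocks n \<pi> \<tau> \<longleftrightarrow>
    \<tau> permutes {1..n} \<and> (\<forall>B\<in>set \<pi>. \<tau> ` B = B \<and> strict_antimono_on B \<tau>)"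

text \<open>Well defined for ordered partitions by \<open>ex1_reverses_blocks\<close> below.\<close>

definition block_reversal :: "nat \<Rightarrow> nat set list \<Rightarrow> nat \<Rightarrow> nat"
  where "block_reversal n \<pi> = (THE \<tau>. reverses_blocks n \<pi> \<tau>)"

definition pi_adjacent :: "nat \<Rightarrow> nat set list \<Rightarrow> (nat \<Rightarrow> nat) \<Rightarrow> (nat \<Rightarrow> nat) \<Rightarrow> bool"
  where "pi_adjacent n \<pi> \<alpha> \<beta> \<longleftrightarrow>
    nontrivial_ordered_partition n \<pi> \<and> \<alpha> \<cdot>\<^sub>r inv \<beta> = block_reversal n \<pi>"

definition perm_adjacent :: "nat \<Rightarrow> (nat \<Rightarrow> nat) \<Rightarrow> (nat \<Rightarrow> nat) \<Rightarrow> bool"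
  where "perm_adjacent n \<alpha> \<beta> \<longleftrightarrow> (\<exists>\<pi>. pi_adjacent n \<pi> \<alpha> \<beta>)"

text \<open>Undirected graphs are symmetric digraphs; see \<open>pair_graph_big_permutograph\<close> below.\<close>

definition big_permutograph :: "nat \<Rightarrow> (nat \<Rightarrow> nat) pair_pre_digraph"
  where "big_permutograph n =
    \<lparr>pverts = {\<alpha>. \<alpha> permutes {1..n}},
     parcs = {(\<alpha>, \<beta>). \<alpha> permutes {1..n} \<and> \<beta> permutes {1..n} \<and> perm_adjacent n \<alpha> \<beta>}\<rparr>"

definition edge_weight :: "nat \<Rightarrow> (nat \<Rightarrow> nat) \<times> (nat \<Rightarrow> nat) \<Rightarrow> real"
  where "edge_weight n = (\<lambda>(\<alpha>, \<beta>). real (perm_dist n \<alpha> \<beta>))"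

text \<open>
  \<open>wf_digraph.\<mu>\<close> is the least cost of a walk between two vertices, and \<open>\<infinity>\<close> if there is none.
\<close>

definition permutograph :: "nat \<Rightarrow> (nat \<Rightarrow> nat) pair_pre_digraph \<Rightarrow> bool"
  where "permutograph n H \<longleftrightarrow>
    subgraph (with_proj H) (with_proj (big_permutograph n)) \<and>
    symmetric (with_proj H) \<and>
    (\<forall>\<alpha>\<in>pverts H. \<forall>\<beta>\<in>pverts H.
      wf_digraph.\<mu> (with_proj H) (edge_weight n) \<alpha> \<beta> =
      wf_digraph.\<mu> (with_proj (big_permutograph n)) (edge_weight n) \<alpha> \<beta>)"

definition DPL_function :: "nat \<Rightarrow> (nat \<Rightarrow> nat) set \<Rightarrow> ((nat \<Rightarrow> nat) \<Rightarrow> nat) \<Rightarrow> bool"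
  where "DPL_function n S F \<longleftrightarrow>
    (\<forall>\<alpha>\<in>S. \<forall>\<beta>\<in>S. \<forall>\<pi>. pi_adjacent n \<pi> \<alpha> \<beta> \<longrightarrow>
      (\<exists>i<length \<pi>. F \<alpha> \<in> \<alpha> ` (\<pi> ! i) \<and> F \<beta> \<in> \<beta> ` (\<pi> ! i)))"

definition separation_property :: "nat \<Rightarrow> (nat \<Rightarrow> nat) set \<Rightarrow> ((nat \<Rightarrow> nat) \<Rightarrow> nat) \<Rightarrow> bool"
  where "separation_property n S F \<longleftrightarrow>
    (\<forall>\<alpha>\<in>S. \<forall>\<beta>\<in>S. \<exists>u\<in>{1..n}. perm_le \<alpha> u (F \<alpha>) \<and> perm_le \<beta> (F \<beta>) u)"

lemma ordered_partition_cmp: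
  assumes "ordered_partition n \<pi>" "A \<in> set \<pi>" "B \<in> set \<pi>" "A \<noteq> B"
  shows "(\<forall>x\<in>A. \<forall>y\<in>B. x < y) \<or> (\<forall>x\<in>A. \<forall>y\<in>B. y < x)"
proof -
  obtain i j where ij: "i < length \<pi>" "A = \<pi> ! i" "j < length \<pi>" "B = \<pi> ! j"
    using assms(2,3) by (metis in_set_conv_nth)
  then have "i < j \<or> j < i" using assms(4) by (metis nat_neq_iff)
  moreover have s: "sorted_wrt (\<lambda>A B. \<forall>x\<in>A. \<forall>y\<in>B. x < y) \<pi>"
    using assms(1) by (simp add: ordered_partition_def)
  ultimately show ?thesis
    using ij sorted_wrt_nth_less[OF s, of i j] sorted_wrt_nth_less[OF s, of j i] by blast
qed

lemma ordered_partition_block_interval: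
  assumes "ordered_partition n \<pi>" "B \<in> set \<pi>"
  shows "finite B" "B \<noteq> {}" "B = {Min B..Max B}"
proof -
  have P: "partition_on {1..n} (set \<pi>)"
    using assms(1) by (simp add: ordered_partition_def)
  have sub: "B \<subseteq> {1..n}" using P assms(2) by (auto simp: partition_on_def)
  then show fin: "finite B" using finite_subset by blast
  show ne: "B \<noteq> {}" using P assms(2) by (auto simp: partition_on_def)
  have "z \<in> B" if z: "Min B \<le> z" "z \<le> Max B" for z
  proof (rule ccontr)
    assume "z \<notin> B"
    have "z \<in> {1..n}" using z sub Min_in[OF fin ne] Max_in[OF fin ne] by fastforce
    then obtain C where C: "C \<in> set \<pi>" "z \<in> C" using P unfolding partition_on_def by blast
    with \<open>z \<notin> B\<close> have "C \<noteq> B" by auto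
    from ordered_partition_cmp[OF assms(1) C(1) assms(2) this]
    show False using C(2) z Min_in[OF fin ne] Max_in[OF fin ne] by force
  qed
  then have "{Min B..Max B} \<subseteq> B" by auto
  moreover have "B \<subseteq> {Min B..Max B}" using fin by auto
  ultimately show "B = {Min B..Max B}" by (rule subset_antisym[rotated])
qed

lemma strict_antimono_image_unique:
  fixes f g :: "nat \<Rightarrow> nat"
  assumes "finite B" "f ` B = B" "g ` B = B" "strict_antimono_on B f" "strict_antimono_on B g"
    and "x \<in> B"
  shows "f x = g x"
proof -
  have rank: "{y \<in> B. y < h x} = h ` {z \<in> B. x < z} \<and> inj_on h B"
    if h: "h ` B = B" "strict_antimono_on B h" for h :: "nat \<Rightarrow> nat"
  proof -
    have lt: "h b < h a \<longleftrightarrow> a < b" if "a \<in> B" "b \<in> B" for a b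
      using h(2) that by (metis (mono_tags, lifting) monotone_onD less_asym nat_neq_iff)
    have "inj_on h B" using lt by (metis inj_onI less_irrefl nat_neq_iff)
    moreover have "{y \<in> B. y < h x} = h ` {z \<in> B. x < z}"
    proof (intro set_eqI iffI)
      fix y assume y: "y \<in> {y \<in> B. y < h x}"
      then obtain z where "z \<in> B" "y = h z" using h(1) by auto
      with y lt[OF assms(6)] show "y \<in> h ` {z \<in> B. x < z}" by auto
    next
      fix y assume "y \<in> h ` {z \<in> B. x < z}"
      then show "y \<in> {y \<in> B. y < h x}" using lt[OF assms(6)] h(1) by auto
    qed
    ultimately show ?thesis by simp
  qed
  have c: "card {y \<in> B. y < h x} = card {z \<in> B. x < z}"
    if h: "h ` B = B" "strict_antimono_on B h" for h :: "nat \<Rightarrow> nat"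
    using rank[OF h] by (metis (no_types, lifting) card_image inj_on_subset mem_Collect_eq subsetI)
  have mono: "card {y \<in> B. y < a} < card {y \<in> B. y < b}" if "a \<in> B" "a < b" for a b
    by (rule psubset_card_mono) (use assms(1) that in auto)
  have "f x \<in> B" "g x \<in> B" using assms(2,3,6) by auto
  moreover have "card {y \<in> B. y < f x} = card {y \<in> B. y < g x}"
    using c[OF assms(2,4)] c[OF assms(3,5)] by simp
  ultimately show ?thesis
    using mono[of "f x" "g x"] mono[of "g x" "f x"] by (cases "f x" "g x" rule: linorder_cases) auto
qed

lemma ex1_reverses_blocks:
  assumes "ordered_partition n \<pi>"
  shows "\<exists>!\<tau>. reverses_blocks n \<pi> \<tau>"
proof -
  have P: "partition_on {1..n} (set \<pi>)"
    using assms by (simp add: ordered_partition_def)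
  define blk where "blk x = (THE B. B \<in> set \<pi> \<and> x \<in> B)" for x
  have blk: "blk x = B" if "B \<in> set \<pi>" "x \<in> B" for x B
    unfolding blk_def
    by (rule the_equality) (use that P in \<open>auto simp: partition_on_def disjoint_def\<close>)
  define f where "f x = (if x \<in> {1..n} then Min (blk x) + Max (blk x) - x else x)" for x
  have inB: "x \<in> {1..n}" if "B \<in> set \<pi>" "x \<in> B" for x B
    using that P unfolding partition_on_def by blast
  have fB: "f x = Min B + Max B - x" if "B \<in> set \<pi>" "x \<in> B" for x B
    using blk[OF that] inB[OF that] by (simp add: f_def)
  have bd: "Min B \<le> x \<and> x \<le> Max B" if "B \<in> set \<pi>" "x \<in> B" for x B
    using ordered_partition_block_interval(1)[OF assms that(1)] that(2) by simp
  have fin: "f x \<in> B" if "B \<in> set \<pi>" "x \<in> B" for x B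
  proof -
    have "f x \<in> {Min B..Max B}" using fB[OF that] bd[OF that] by auto
    then show ?thesis using ordered_partition_block_interval(3)[OF assms that(1)] by simp
  qed
  have ffB: "f (f x) = x" if "B \<in> set \<pi>" "x \<in> B" for x B
    using fB[OF that] fB[OF that(1) fin[OF that]] bd[OF that] by simp
  have ff: "f (f x) = x" for x
  proof (cases "x \<in> {1..n}")
    case True
    then obtain B where "B \<in> set \<pi>" "x \<in> B" using P unfolding partition_on_def by blast
    then show ?thesis by (rule ffB)
  next
    case False
    then have "f x = x" unfolding f_def by (rule if_not_P)
    then show ?thesis by simp
  qed
  have "f permutes {1..n}"
    unfolding permutes_def
  proof (intro conjI allI impI)
    show "f x = x" if "x \<notin> {1..n}" for x
      using that unfolding f_def by (rule if_not_P)
    show "\<exists>!x. f x = y" for y using ff by metis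
  qed
  moreover have "f ` B = B" if "B \<in> set \<pi>" for B
  proof
    show "f ` B \<subseteq> B" using fin[OF that] by auto
    show "B \<subseteq> f ` B" using fin[OF that] ff by (metis imageI subsetI)
  qed
  moreover have "strict_antimono_on B f" if "B \<in> set \<pi>" for B
  proof (rule monotone_onI)
    fix x y assume xy: "x \<in> B" "y \<in> B" "x < y"
    show "f y < f x"
      using fB[OF that xy(1)] fB[OF that xy(2)] bd[OF that xy(1)] bd[OF that xy(2)] xy(3) by simp
  qed
  ultimately have ex: "reverses_blocks n \<pi> f" by (simp add: reverses_blocks_def)
  show ?thesis
  proof (rule ex1I[of _ f], rule ex)
    fix g assume g: "reverses_blocks n \<pi> g"
    show "g = f"
    proof
      fix x
      show "g x = f x"
      proof (cases "x \<in> {1..n}")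
        case True
        then obtain B where B: "B \<in> set \<pi>" "x \<in> B" using P unfolding partition_on_def by blast
        show ?thesis
          using strict_antimono_image_unique[of B g f x] B g ex
            ordered_partition_block_interval(1)[OF assms B(1)]
          by (simp add: reverses_blocks_def)
      next
        case False
        then show ?thesis
          using g ex unfolding reverses_blocks_def by (metis permutes_not_in)
      qed
    qed
  qed
qed

lemma reverses_block_reversal:
  assumes "ordered_partition n \<pi>"
  shows "reverses_blocks n \<pi> (block_reversal n \<pi>)"
proof -
  obtain \<tau> where t: "reverses_blocks n \<pi> \<tau>"
    and u: "\<And>\<sigma>. reverses_blocks n \<pi> \<sigma> \<Longrightarrow> \<sigma> = \<tau>"
    using ex1_reverses_blocks[OF assms] by (elim ex1E) blast
  then have "block_reversal n \<pi> = \<tau>"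
    unfolding block_reversal_def by (intro the_equality)
  with t show ?thesis by simp
qed

lemma inv_block_reversal:
  assumes "ordered_partition n \<pi>"
  shows "inv (block_reversal n \<pi>) = block_reversal n \<pi>"
proof -
  let ?t = "block_reversal n \<pi>"
  have r: "reverses_blocks n \<pi> ?t" by (rule reverses_block_reversal[OF assms])
  then have p: "?t permutes {1..n}" by (simp add: reverses_blocks_def)
  have "reverses_blocks n \<pi> (inv ?t)"
    unfolding reverses_blocks_def
  proof (intro conjI ballI)
    show "inv ?t permutes {1..n}" by (rule permutes_inv[OF p])
    fix B assume B: "B \<in> set \<pi>"
    then have tB: "?t ` B = B" "strict_antimono_on B ?t" using r by (auto simp: reverses_blocks_def)
    show iB: "inv ?t ` B = B"
      using tB(1) permutes_inj[OF p] by (metis image_inv_f_f)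
    show "strict_antimono_on B (inv ?t)"
    proof (rule monotone_onI)
      fix x y assume xy: "x \<in> B" "y \<in> B" "x < y"
      have m: "inv ?t x \<in> B" "inv ?t y \<in> B" using iB xy by auto
      have e: "?t (inv ?t x) = x" "?t (inv ?t y) = y" using permutes_inverses(1)[OF p] by auto
      show "inv ?t y < inv ?t x"
        using monotone_onD[OF tB(2) m] e xy(3)
        by (cases "inv ?t x" "inv ?t y" rule: linorder_cases) auto
    qed
  qed
  moreover obtain g where "\<And>\<tau>. reverses_blocks n \<pi> \<tau> \<Longrightarrow> \<tau> = g"
    using ex1_reverses_blocks[OF assms] by (elim ex1E) blast
  ultimately show ?thesis using r by metis
qed

lemma ordered_partition_singletons:
  assumes "ordered_partition n \<pi>" and single: "\<And>B. B \<in> set \<pi> \<Longrightarrow> \<exists>x. B = {x}"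
  shows "\<pi> = trivial_partition n"
proof -
  let ?xs = "map Min \<pi>"
  have eq: "B = {Min B}" if "B \<in> set \<pi>" for B using single[OF that] by auto
  have s: "sorted_wrt (\<lambda>A B. \<forall>x\<in>A. \<forall>y\<in>B. x < y) \<pi>" and P: "\<Union>(set \<pi>) = {1..n}"
    using assms(1) by (simp_all add: ordered_partition_def partition_on_def)
  have "sorted_wrt (<) ?xs"
    unfolding sorted_wrt_map
    by (rule sorted_wrt_mono_rel[OF _ s]) (metis eq singletonI)
  moreover have "set ?xs = set [1..<Suc n]"
  proof -
    have "set ?xs = \<Union>(set \<pi>)"
    proof (intro set_eqI iffI)
      fix x assume "x \<in> set ?xs"
      then show "x \<in> \<Union>(set \<pi>)" using eq by auto
    next
      fix x assume "x \<in> \<Union>(set \<pi>)"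
      then obtain B where "B \<in> set \<pi>" "x \<in> B" by blast
      then show "x \<in> set ?xs" using eq[of B] by auto
    qed
    then show ?thesis using P by auto
  qed
  ultimately have "?xs = [1..<Suc n]"
    by (metis strict_sorted_equal sorted_wrt_upt)
  moreover have "\<pi> = map (\<lambda>k. {k}) ?xs"
    using eq by (simp add: comp_def) (metis (no_types, lifting) map_idI)
  ultimately show ?thesis unfolding trivial_partition_def by simp
qed

lemma block_reversal_neq_id:
  assumes "nontrivial_ordered_partition n \<pi>"
  shows "block_reversal n \<pi> \<noteq> id"
proof
  assume "block_reversal n \<pi> = id"
  moreover have o: "ordered_partition n \<pi>"
    using assms by (simp add: nontrivial_ordered_partition_def)
  ultimately have am: "strict_antimono_on B id" if "B \<in> set \<pi>" for B :: "nat set"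
    using reverses_block_reversal[OF o] that by (simp add: reverses_blocks_def)
  have "\<exists>x. B = {x}" if B: "B \<in> set \<pi>" for B
  proof -
    obtain x where x: "x \<in> B" using ordered_partition_block_interval(2)[OF o B] by blast
    have "y = x" if "y \<in> B" for y
      using monotone_onD[OF am[OF B] x that] monotone_onD[OF am[OF B] that x]
      by (cases x y rule: linorder_cases) auto
    then show ?thesis using x by blast
  qed
  then show False
    using ordered_partition_singletons[OF o] assms by (simp add: nontrivial_ordered_partition_def)
qed

lemma pair_graph_big_permutograph: "pair_graph (big_permutograph n)"
proof -
  let ?V = "{\<alpha>. \<alpha> permutes {1..n}}"
  have fin: "finite ?V" by (rule finite_permutations) simp
  have sym: "perm_adjacent n \<beta> \<alpha>"
    if h: "\<alpha> permutes {1..n}" "\<beta> permutes {1..n}" "perm_adjacent n \<alpha> \<beta>" for \<alpha> \<beta>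
  proof -
    obtain \<pi> where \<pi>: "nontrivial_ordered_partition n \<pi>" "inv \<beta> \<circ> \<alpha> = block_reversal n \<pi>"
      using h(3) by (auto simp: perm_adjacent_def pi_adjacent_def perm_mult_def)
    have "inv \<alpha> \<circ> \<beta> = inv (inv \<beta> \<circ> \<alpha>)"
      using h(1,2) by (simp add: o_inv_distrib permutes_bij bij_imp_bij_inv inv_inv_eq)
    then show ?thesis
      using \<pi> inv_block_reversal[of n \<pi>]
      by (auto simp: perm_adjacent_def pi_adjacent_def perm_mult_def nontrivial_ordered_partition_def)
  qed
  have irr: "\<not> perm_adjacent n \<alpha> \<alpha>" if "\<alpha> permutes {1..n}" for \<alpha>
    using that
    by (auto simp: perm_adjacent_def pi_adjacent_def perm_mult_def permutes_inv_o
        dest: block_reversal_neq_id)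
  show ?thesis
  proof
    show "finite (parcs (big_permutograph n))"
      by (rule finite_subset[of _ "?V \<times> ?V"]) (use fin in \<open>auto simp: big_permutograph_def\<close>)
    show "symmetric (with_proj (big_permutograph n))"
      by (auto simp: symmetric_def big_permutograph_def sym_def intro: sym)
  qed (use fin irr in \<open>auto simp: big_permutograph_def\<close>)
qed

end

theory Submission
  imports Defs
begin

text \<open>
  Two \<open>\<pi>\<close>-adjacent permutations cut \<open>X\<close> into the same blocks, in the same order, so separation
  applied to both orders of an adjacent pair forces the two values of \<open>F\<close> into the same block.
  Conversely, sorting by adjacent transpositions shows that the weighted path distance in the big
  permutograph is \<open>perm_dist\<close>, so any two vertices of a permutograph are joined by a walk inside it
  along which every pair of elements is swapped at most once. A separating element is carried
  backwards along such a walk: if \<open>u \<le>\<^sub>\<gamma> F \<gamma>\<close> but not \<open>u \<le>\<^sub>\<alpha> F \<alpha>\<close> for an edge from \<open>\<alpha>\<close> to \<open>\<gamma>\<close>, then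
  \<open>u\<close> and \<open>F \<alpha>\<close> are swapped on this edge and hence never again, so that \<open>F \<alpha>\<close> can replace \<open>u\<close>.
\<close>

section \<open>Blocks of a permutation\<close>

definition perm_block :: "nat set list \<Rightarrow> (nat \<Rightarrow> nat) \<Rightarrow> nat \<Rightarrow> nat"
  where "perm_block \<pi> \<alpha> x = (LEAST i. i < length \<pi> \<and> x \<in> \<alpha> ` (\<pi> ! i))"

lemma ordered_partition_nth_less:
  assumes "ordered_partition n \<pi>" "i < j" "j < length \<pi>" "x \<in> \<pi> ! i" "y \<in> \<pi> ! j"
  shows "x < y"
  using assms sorted_wrt_nth_less unfolding ordered_partition_def by blast

lemma perm_block_eqI:
  assumes "ordered_partition n \<pi>" "\<alpha> permutes {1..n}" "i < length \<pi>" "x \<in> \<alpha> ` (\<pi> ! i)"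
  shows "perm_block \<pi> \<alpha> x = i"
  unfolding perm_block_def
proof (rule Least_equality)
  fix j assume j: "j < length \<pi> \<and> x \<in> \<alpha> ` (\<pi> ! j)"
  then have "inv \<alpha> x \<in> \<pi> ! i" "inv \<alpha> x \<in> \<pi> ! j"
    using assms(4) permutes_inverses(2)[OF assms(2)] by (metis imageE)+
  then show "i \<le> j"
    using ordered_partition_nth_less[OF assms(1) _ assms(3), of j] by (meson less_irrefl not_le)
qed (use assms in blast)

lemma perm_block_in_range:
  assumes "ordered_partition n \<pi>" "\<alpha> permutes {1..n}" "x \<in> {1..n}"
  shows "perm_block \<pi> \<alpha> x < length \<pi>" "x \<in> \<alpha> ` (\<pi> ! perm_block \<pi> \<alpha> x)"
proof -
  have "inv \<alpha> x \<in> \<Union> (set \<pi>)"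
    using assms permutes_in_image[OF permutes_inv[OF assms(2)]]
    by (simp add: ordered_partition_def partition_on_def)
  then obtain i where "i < length \<pi>" "inv \<alpha> x \<in> \<pi> ! i" by (auto simp: in_set_conv_nth)
  then have "i < length \<pi> \<and> x \<in> \<alpha> ` (\<pi> ! i)"
    using permutes_inverses(1)[OF assms(2)] by (metis imageI)
  from LeastI[of "\<lambda>i. i < length \<pi> \<and> x \<in> \<alpha> ` (\<pi> ! i)", OF this]
  show "perm_block \<pi> \<alpha> x < length \<pi>" "x \<in> \<alpha> ` (\<pi> ! perm_block \<pi> \<alpha> x)"
    by (simp_all add: perm_block_def)
qed

lemma inv_in_perm_block:
  assumes "ordered_partition n \<pi>" "\<alpha> permutes {1..n}" "x \<in> {1..n}"
  shows "inv \<alpha> x \<in> \<pi> ! perm_block \<pi> \<alpha> x"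
  using perm_block_in_range(2)[OF assms] permutes_inverses(2)[OF assms(2)] by auto

lemma perm_block_mono:
  assumes "ordered_partition n \<pi>" "\<alpha> permutes {1..n}" "x \<in> {1..n}" "y \<in> {1..n}"
    and "perm_le \<alpha> x y"
  shows "perm_block \<pi> \<alpha> x \<le> perm_block \<pi> \<alpha> y"
proof (rule ccontr)
  assume "\<not> perm_block \<pi> \<alpha> x \<le> perm_block \<pi> \<alpha> y"
  then have "inv \<alpha> y < inv \<alpha> x"
    using ordered_partition_nth_less[OF assms(1) _ perm_block_in_range(1)[OF assms(1-3)]]
      inv_in_perm_block[OF assms(1,2)] assms(3,4) by (meson not_le)
  with \<open>perm_le \<alpha> x y\<close> show False by (simp add: perm_le_def)
qed

lemma pi_adjacent_ordered_partition:
  "pi_adjacent n \<pi> \<alpha> \<beta> \<Longrightarrow> ordered_partition n \<pi>"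
  by (simp add: pi_adjacent_def nontrivial_ordered_partition_def)

lemma pi_adjacent_eq_comp:
  assumes "\<beta> permutes {1..n}" "pi_adjacent n \<pi> \<alpha> \<beta>"
  shows "\<alpha> = \<beta> \<circ> block_reversal n \<pi>"
  using assms permutes_inv_o(1)[OF assms(1)]
  by (metis comp_assoc id_comp perm_mult_def pi_adjacent_def)

lemma pi_adjacent_perm_block:
  assumes "\<beta> permutes {1..n}" "pi_adjacent n \<pi> \<alpha> \<beta>"
  shows "perm_block \<pi> \<alpha> = perm_block \<pi> \<beta>"
proof -
  have "block_reversal n \<pi> ` B = B" if "B \<in> set \<pi>" for B
    using reverses_block_reversal[OF pi_adjacent_ordered_partition[OF assms(2)]] that
    by (simp add: reverses_blocks_def)
  then have "\<alpha> ` B = \<beta> ` B" if "B \<in> set \<pi>" for B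
    using that pi_adjacent_eq_comp[OF assms] by (metis image_comp)
  then have "i < length \<pi> \<and> x \<in> \<alpha> ` (\<pi> ! i) \<longleftrightarrow> i < length \<pi> \<and> x \<in> \<beta> ` (\<pi> ! i)" for i x
    using nth_mem by blast
  then show ?thesis by (simp add: perm_block_def fun_eq_iff)
qed

lemma pi_adjacent_reverses:
  assumes \<alpha>: "\<alpha> permutes {1..n}" and \<beta>: "\<beta> permutes {1..n}" and adj: "pi_adjacent n \<pi> \<alpha> \<beta>"
    and xy: "x \<in> {1..n}" "y \<in> {1..n}" "perm_block \<pi> \<alpha> x = perm_block \<pi> \<alpha> y"
    and "perm_less \<alpha> x y"
  shows "perm_less \<beta> y x"
proof -
  let ?\<tau> = "block_reversal n \<pi>" and ?B = "\<pi> ! perm_block \<pi> \<alpha> x"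
  note partition = pi_adjacent_ordered_partition[OF adj]
  have inv_\<beta>: "inv \<beta> z = ?\<tau> (inv \<alpha> z)" for z
    using pi_adjacent_eq_comp[OF \<beta> adj] permutes_inverses(1)[OF \<alpha>, of z]
    by (metis comp_apply permutes_inverses(2)[OF \<beta>])
  have "?B \<in> set \<pi>" using perm_block_in_range(1)[OF partition \<alpha> xy(1)] by simp
  then have antimono: "strict_antimono_on ?B ?\<tau>"
    using reverses_block_reversal[OF partition] by (simp add: reverses_blocks_def)
  have "inv \<alpha> x \<in> ?B" "inv \<alpha> y \<in> ?B"
    using inv_in_perm_block[OF partition \<alpha>] xy by metis+
  from monotone_onD[OF antimono this] show ?thesis
    using \<open>perm_less \<alpha> x y\<close> by (simp add: perm_less_def inv_\<beta>)
qed

lemma DPL_function_iff_perm_block: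
  assumes S: "S \<subseteq> {\<alpha>. \<alpha> permutes {1..n}}" and F: "F \<in> S \<rightarrow> {1..n}"
  shows "DPL_function n S F \<longleftrightarrow>
    (\<forall>\<alpha>\<in>S. \<forall>\<beta>\<in>S. \<forall>\<pi>. pi_adjacent n \<pi> \<alpha> \<beta> \<longrightarrow> perm_block \<pi> \<alpha> (F \<alpha>) = perm_block \<pi> \<beta> (F \<beta>))"
proof -
  have "(\<exists>i<length \<pi>. F \<alpha> \<in> \<alpha> ` (\<pi> ! i) \<and> F \<beta> \<in> \<beta> ` (\<pi> ! i)) \<longleftrightarrow>
      perm_block \<pi> \<alpha> (F \<alpha>) = perm_block \<pi> \<beta> (F \<beta>)"
    if "\<alpha> \<in> S" "\<beta> \<in> S" "pi_adjacent n \<pi> \<alpha> \<beta>" for \<alpha> \<beta> \<pi>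
  proof -
    note partition = pi_adjacent_ordered_partition[OF that(3)]
    have "\<alpha> permutes {1..n}" "\<beta> permutes {1..n}" using S that by auto
    moreover have "F \<alpha> \<in> {1..n}" "F \<beta> \<in> {1..n}" using F that by auto
    ultimately show ?thesis
      using perm_block_eqI[OF partition] perm_block_in_range[OF partition] by metis
  qed
  then show ?thesis unfolding DPL_function_def by blast
qed

lemma separation_property_imp_DPL_function:
  assumes S: "S \<subseteq> {\<alpha>. \<alpha> permutes {1..n}}" and F: "F \<in> S \<rightarrow> {1..n}"
    and sep: "separation_property n S F"
  shows "DPL_function n S F"
  unfolding DPL_function_iff_perm_block[OF S F]
proof (intro ballI allI impI)
  fix \<alpha> \<beta> \<pi> assume \<alpha>\<beta>: "\<alpha> \<in> S" "\<beta> \<in> S" and adj: "pi_adjacent n \<pi> \<alpha> \<beta>"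
  have block_le: "perm_block \<pi> \<delta> (F \<delta>) \<le> perm_block \<pi> \<gamma> (F \<gamma>)"
    if "\<gamma> \<in> S" "\<delta> \<in> S" and same: "perm_block \<pi> \<gamma> = perm_block \<pi> \<delta>" for \<gamma> \<delta>
  proof -
    obtain u where u: "u \<in> {1..n}" "perm_le \<gamma> u (F \<gamma>)" "perm_le \<delta> (F \<delta>) u"
      using sep \<open>\<gamma> \<in> S\<close> \<open>\<delta> \<in> S\<close> unfolding separation_property_def by blast
    note mono = perm_block_mono[OF pi_adjacent_ordered_partition[OF adj]]
    have "perm_block \<pi> \<delta> (F \<delta>) \<le> perm_block \<pi> \<delta> u"
      using mono S F \<open>\<delta> \<in> S\<close> u by blast
    also have "\<dots> = perm_block \<pi> \<gamma> u" by (simp add: same)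
    also have "\<dots> \<le> perm_block \<pi> \<gamma> (F \<gamma>)"
      using mono S F \<open>\<gamma> \<in> S\<close> u by blast
    finally show ?thesis .
  qed
  have "perm_block \<pi> \<alpha> = perm_block \<pi> \<beta>"
    using S \<alpha>\<beta> adj by (blast intro: pi_adjacent_perm_block)
  with \<alpha>\<beta> show "perm_block \<pi> \<alpha> (F \<alpha>) = perm_block \<pi> \<beta> (F \<beta>)"
    by (intro antisym block_le) simp_all
qed

section \<open>Inversions\<close>

lemma finite_inversions [simp]: "finite (inversions n \<alpha> \<beta>)"
  by (rule finite_subset[of _ "Pow {1..n}"]) (auto simp: inversions_def)

lemma pair_in_inversions_iff:
  assumes "x \<in> {1..n}" "y \<in> {1..n}"
  shows "{x, y} \<in> inversions n \<alpha> \<beta> \<longleftrightarrow>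
    perm_less \<alpha> x y \<and> perm_less \<beta> y x \<or> perm_less \<alpha> y x \<and> perm_less \<beta> x y"
  using assms by (auto simp: inversions_def doubleton_eq_iff)

lemma perm_less_linear:
  assumes "\<alpha> permutes S" "x \<noteq> y"
  shows "perm_less \<alpha> x y \<or> perm_less \<alpha> y x"
  using assms permutes_inverses(1)[OF assms(1)] unfolding perm_less_def by (metis nat_neq_iff)

lemma inversions_subset_Un:
  assumes "\<gamma> permutes {1..n}"
  shows "inversions n \<alpha> \<beta> \<subseteq> inversions n \<alpha> \<gamma> \<union> inversions n \<gamma> \<beta>"
proof
  fix e assume "e \<in> inversions n \<alpha> \<beta>"
  then obtain x y where pair: "e = {x, y}" and xy: "x \<in> {1..n}" "y \<in> {1..n}"
    "perm_less \<alpha> x y" "perm_less \<beta> y x"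
    unfolding inversions_def by blast
  then have "perm_less \<gamma> x y \<or> perm_less \<gamma> y x"
    using perm_less_linear[OF assms, of x y] by (auto simp: perm_less_def)
  then show "e \<in> inversions n \<alpha> \<gamma> \<union> inversions n \<gamma> \<beta>"
    using xy by (auto simp: pair pair_in_inversions_iff)
qed

lemma perm_dist_triangle:
  assumes "\<gamma> permutes {1..n}"
  shows "perm_dist n \<alpha> \<beta> \<le> perm_dist n \<alpha> \<gamma> + perm_dist n \<gamma> \<beta>"
  unfolding perm_dist_def
  using card_mono[OF _ inversions_subset_Un[OF assms, of \<alpha> \<beta>]]
    card_Un_le[of "inversions n \<alpha> \<gamma>" "inversions n \<gamma> \<beta>"]
  by simp

lemma inversions_disjoint_if_perm_dist_additive:
  assumes "\<gamma> permutes {1..n}" "perm_dist n \<alpha> \<beta> = perm_dist n \<alpha> \<gamma> + perm_dist n \<gamma> \<beta>"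
  shows "inversions n \<alpha> \<gamma> \<inter> inversions n \<gamma> \<beta> = {}"
proof -
  let ?A = "inversions n \<alpha> \<gamma>" and ?B = "inversions n \<gamma> \<beta>"
  have "card ?A + card ?B \<le> card (?A \<union> ?B)"
    using assms(2) card_mono[OF _ inversions_subset_Un[OF assms(1), of \<alpha> \<beta>]]
    by (simp add: perm_dist_def)
  moreover have "card ?A + card ?B = card (?A \<union> ?B) + card (?A \<inter> ?B)"
    by (rule card_Un_Int) simp_all
  ultimately have "card (?A \<inter> ?B) = 0" by simp
  then show ?thesis by simp
qed

lemma perm_dist_self [simp]: "perm_dist n \<alpha> \<alpha> = 0"
proof -
  have "inversions n \<alpha> \<alpha> = {}" by (auto simp: inversions_def perm_less_def)
  then show ?thesis by (simp add: perm_dist_def)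
qed

section \<open>Adjacent transpositions\<close>

definition transposition_partition :: "nat \<Rightarrow> nat \<Rightarrow> nat set list"
  where "transposition_partition n k =
    map (\<lambda>i. {i}) [1..<k] @ {k, Suc k} # map (\<lambda>i. {i}) [Suc (Suc k)..<Suc n]"

lemma set_transposition_partition:
  assumes "k \<in> {1..<n}"
  shows "set (transposition_partition n k) =
    insert {k, Suc k} ((\<lambda>i. {i}) ` ({1..n} - {k, Suc k}))"
proof -
  have "{1..n} - {k, Suc k} = {1..<k} \<union> {Suc (Suc k)..<Suc n}" using assms by auto
  then show ?thesis by (simp add: transposition_partition_def image_Un del: upt_Suc)
qed

lemma nontrivial_transposition_partition:
  assumes "k \<in> {1..<n}"
  shows "nontrivial_ordered_partition n (transposition_partition n k)"
proof -
  let ?\<pi> = "transposition_partition n k"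
  have "partition_on {1..n} (set ?\<pi>)"
    using assms
    by (auto simp: set_transposition_partition[OF assms] partition_on_def disjoint_def)
  moreover have "sorted_wrt (\<lambda>A B. \<forall>x\<in>A. \<forall>y\<in>B. x < y) ?\<pi>"
    by (auto simp: transposition_partition_def sorted_wrt_append sorted_wrt_map simp del: upt_Suc)
  moreover have "{k, Suc k} \<in> set ?\<pi>" "{k, Suc k} \<notin> set (trivial_partition n)"
    by (auto simp: transposition_partition_def trivial_partition_def doubleton_eq_iff
        simp del: upt_Suc)
  ultimately show ?thesis
    by (auto simp: nontrivial_ordered_partition_def ordered_partition_def)
qed

lemma block_reversal_transposition_partition:
  assumes "k \<in> {1..<n}"
  shows "block_reversal n (transposition_partition n k) = transpose k (Suc k)"
proof -
  have "ordered_partition n (transposition_partition n k)"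
    using nontrivial_transposition_partition[OF assms]
    by (simp add: nontrivial_ordered_partition_def)
  moreover have "reverses_blocks n (transposition_partition n k) (transpose k (Suc k))"
    using assms
    by (auto simp: reverses_blocks_def set_transposition_partition[OF assms] monotone_on_def
        intro!: permutes_swap_id)
  ultimately show ?thesis
    using ex1_reverses_blocks reverses_block_reversal by blast
qed

lemma perm_adjacent_transpose:
  assumes "\<alpha> permutes {1..n}" "k \<in> {1..<n}"
  shows "perm_adjacent n \<alpha> (\<alpha> \<circ> transpose k (Suc k))"
proof -
  have "inv (\<alpha> \<circ> transpose k (Suc k)) \<circ> \<alpha> = transpose k (Suc k) \<circ> (inv \<alpha> \<circ> \<alpha>)"
    using permutes_bij[OF assms(1)] by (simp add: o_inv_distrib comp_assoc)
  also have "\<dots> = transpose k (Suc k)" using permutes_inv_o(2)[OF assms(1)] by simp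
  finally show ?thesis
    unfolding perm_adjacent_def pi_adjacent_def perm_mult_def
    using nontrivial_transposition_partition[OF assms(2)]
      block_reversal_transposition_partition[OF assms(2)] by metis
qed

lemma perm_less_comp_transpose_iff:
  assumes "\<alpha> permutes S"
  shows "perm_less (\<alpha> \<circ> transpose k (Suc k)) x y \<longleftrightarrow>
    (perm_less \<alpha> x y \<and> \<not> (x = \<alpha> k \<and> y = \<alpha> (Suc k))) \<or> (x = \<alpha> (Suc k) \<and> y = \<alpha> k)"
proof -
  have "inv (\<alpha> \<circ> transpose k (Suc k)) z = transpose k (Suc k) (inv \<alpha> z)" for z
    using permutes_bij[OF assms] by (simp add: o_inv_distrib)
  moreover have "inv \<alpha> z = i \<longleftrightarrow> z = \<alpha> i" for z i
    using permutes_inverses[OF assms] by metis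
  moreover have "transpose k (Suc k) i < transpose k (Suc k) j \<longleftrightarrow>
      (i < j \<and> \<not> (i = k \<and> j = Suc k)) \<or> (i = Suc k \<and> j = k)" for i j
    by (auto simp: transpose_def)
  ultimately show ?thesis by (simp add: perm_less_def)
qed

lemma inversions_comp_transpose:
  assumes "\<alpha> permutes S" "perm_less \<beta> (\<alpha> (Suc k)) (\<alpha> k)"
  shows "inversions n (\<alpha> \<circ> transpose k (Suc k)) \<beta> = inversions n \<alpha> \<beta> - {{\<alpha> k, \<alpha> (Suc k)}}"
proof -
  let ?a = "\<alpha> k" and ?b = "\<alpha> (Suc k)"
  have less: "perm_less \<alpha> ?a ?b" by (simp add: perm_less_def permutes_inverses[OF assms(1)])
  have not_less: "\<not> perm_less \<alpha> ?b ?a" "\<not> perm_less \<beta> ?a ?b"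
    using less assms(2) by (simp_all add: perm_less_def)
  have inverted_iff: "perm_less (\<alpha> \<circ> transpose k (Suc k)) x y \<and> perm_less \<beta> y x \<longleftrightarrow>
      perm_less \<alpha> x y \<and> perm_less \<beta> y x \<and> {x, y} \<noteq> {?a, ?b}" for x y
    using less assms(2) not_less
    by (auto simp: perm_less_comp_transpose_iff[OF assms(1)] doubleton_eq_iff)
  show ?thesis unfolding inversions_def inverted_iff by blast
qed

lemma perm_dist_comp_transpose:
  assumes \<alpha>: "\<alpha> permutes {1..n}" and k: "k \<in> {1..<n}"
    and descent: "perm_less \<beta> (\<alpha> (Suc k)) (\<alpha> k)"
  shows "perm_dist n \<alpha> \<beta> = Suc (perm_dist n (\<alpha> \<circ> transpose k (Suc k)) \<beta>)"
proof -
  have "\<alpha> k \<in> {1..n}" "\<alpha> (Suc k) \<in> {1..n}" using permutes_in_image[OF \<alpha>] k by auto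
  then have "{\<alpha> k, \<alpha> (Suc k)} \<in> inversions n \<alpha> \<beta>"
    using descent by (simp add: pair_in_inversions_iff perm_less_def permutes_inverses[OF \<alpha>])
  then show ?thesis
    unfolding perm_dist_def inversions_comp_transpose[OF \<alpha> descent]
    by (intro card.remove) simp_all
qed

lemma perm_dist_transpose_self:
  assumes "\<alpha> permutes {1..n}" "k \<in> {1..<n}"
  shows "perm_dist n \<alpha> (\<alpha> \<circ> transpose k (Suc k)) = 1"
  using perm_dist_comp_transpose[OF assms, of "\<alpha> \<circ> transpose k (Suc k)"]
  by (simp add: perm_less_comp_transpose_iff[OF assms(1)])

lemma permutes_neq_id_descent:
  assumes perm: "p permutes {1..n}" and "p \<noteq> id"
  shows "\<exists>k\<in>{1..<n}. p (Suc k) < p k"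
proof (rule ccontr)
  assume no_descent: "\<not> (\<exists>k\<in>{1..<n}. p (Suc k) < p k)"
  have ascent: "p k < p (Suc k)" if "k \<in> {1..<n}" for k
    using no_descent that injD[OF permutes_inj[OF perm], of k "Suc k"] by force
  have "k \<le> p k" if "1 \<le> k" "k \<le> n" for k
    using that
  proof (induction k rule: dec_induct)
    case base
    then show ?case using permutes_in_image[OF perm, of 1] by simp
  next
    case (step k)
    then show ?case using ascent[of k] by simp
  qed
  then have "p = id" by (intro permutes_natset_ge[OF perm]) simp
  with \<open>p \<noteq> id\<close> show False ..
qed

lemma permutes_neq_descent:
  assumes "\<alpha> permutes {1..n}" "\<beta> permutes {1..n}" "\<alpha> \<noteq> \<beta>"
  shows "\<exists>k\<in>{1..<n}. perm_less \<beta> (\<alpha> (Suc k)) (\<alpha> k)"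
proof -
  have "inv \<beta> \<circ> \<alpha> permutes {1..n}"
    by (rule permutes_compose[OF assms(1) permutes_inv[OF assms(2)]])
  moreover have "inv \<beta> \<circ> \<alpha> \<noteq> id"
    using assms(3) permutes_inverses(1)[OF assms(2)] by (metis comp_apply ext id_apply)
  ultimately have "\<exists>k\<in>{1..<n}. (inv \<beta> \<circ> \<alpha>) (Suc k) < (inv \<beta> \<circ> \<alpha>) k"
    by (rule permutes_neq_id_descent)
  then show ?thesis by (simp add: perm_less_def)
qed

section \<open>Geodesics\<close>

lemma big_permutograph_simps [simp]:
  "pverts (big_permutograph n) = {\<alpha>. \<alpha> permutes {1..n}}"
  "parcs (big_permutograph n) =
    {(\<alpha>, \<beta>). \<alpha> permutes {1..n} \<and> \<beta> permutes {1..n} \<and> perm_adjacent n \<alpha> \<beta>}"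
  by (simp_all add: big_permutograph_def)

lemma edge_weight_Pair [simp]: "edge_weight n (\<alpha>, \<beta>) = real (perm_dist n \<alpha> \<beta>)"
  by (simp add: edge_weight_def)

locale subpermutograph =
  fixes n :: nat and H :: "(nat \<Rightarrow> nat) pair_pre_digraph"
  assumes subgraph_big: "subgraph (with_proj H) (with_proj (big_permutograph n))"

sublocale subpermutograph \<subseteq> fin_digraph "with_proj H"
proof -
  interpret big: pair_graph "big_permutograph n" by (rule pair_graph_big_permutograph)
  show "fin_digraph (with_proj H)" by (rule big.fin_digraph_subgraph[OF subgraph_big])
qed

context subpermutograph
begin

lemma pverts_subset: "pverts H \<subseteq> {\<alpha>. \<alpha> permutes {1..n}}"
  using subgraph_big by (simp add: subgraph_def)

lemma arc_perm_adjacent: "(\<alpha>, \<beta>) \<in> parcs H \<Longrightarrow> perm_adjacent n \<alpha> \<beta>"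
  using subgraph_big by (auto simp: subgraph_def)

lemma perm_dist_le_awalk_cost:
  assumes "awalk \<alpha> p \<beta>"
  shows "real (perm_dist n \<alpha> \<beta>) \<le> awalk_cost (edge_weight n) p"
  using assms
proof (induction p arbitrary: \<alpha>)
  case Nil
  then show ?case by (simp add: awalk_Nil_iff)
next
  case (Cons e p)
  then obtain \<gamma> where e_eq: "e = (\<alpha>, \<gamma>)" and walk: "awalk \<gamma> p \<beta>"
    by (cases e) (simp add: awalk_Cons_iff)
  have "\<gamma> permutes {1..n}" using pverts_subset awalk_hd_in_verts[OF walk] by auto
  from perm_dist_triangle[OF this, of \<alpha> \<beta>] Cons.IH[OF walk] show ?case by (simp add: e_eq)
qed

lemma perm_dist_le_min_cost: "ereal (real (perm_dist n \<alpha> \<beta>)) \<le> \<mu> (edge_weight n) \<alpha> \<beta>"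
  unfolding \<mu>_def by (rule INF_greatest) (simp add: perm_dist_le_awalk_cost)

definition geodesic :: "(nat \<Rightarrow> nat) \<Rightarrow> ((nat \<Rightarrow> nat) \<times> (nat \<Rightarrow> nat)) list \<Rightarrow> (nat \<Rightarrow> nat) \<Rightarrow> bool"
  where "geodesic \<alpha> p \<beta> \<longleftrightarrow>
    awalk \<alpha> p \<beta> \<and> awalk_cost (edge_weight n) p = real (perm_dist n \<alpha> \<beta>)"

lemma geodesic_Nil_iff: "geodesic \<alpha> [] \<beta> \<longleftrightarrow> \<alpha> = \<beta> \<and> \<alpha> \<in> pverts H"
  by (auto simp: geodesic_def awalk_Nil_iff)

lemma geodesic_Cons_iff:
  "geodesic \<alpha> (e # p) \<beta> \<longleftrightarrow> (\<exists>\<gamma>. e = (\<alpha>, \<gamma>) \<and> e \<in> parcs H \<and> geodesic \<gamma> p \<beta> \<and>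
    perm_dist n \<alpha> \<beta> = perm_dist n \<alpha> \<gamma> + perm_dist n \<gamma> \<beta>)"
proof
  assume geo: "geodesic \<alpha> (e # p) \<beta>"
  then obtain \<gamma> where arc: "e = (\<alpha>, \<gamma>)" "e \<in> parcs H" and walk: "awalk \<gamma> p \<beta>"
    by (cases e) (simp add: geodesic_def awalk_Cons_iff)
  have "\<gamma> permutes {1..n}" using pverts_subset awalk_hd_in_verts[OF walk] by auto
  note triangle = perm_dist_triangle[OF this, of \<alpha> \<beta>]
  have "real (perm_dist n \<alpha> \<gamma>) + awalk_cost (edge_weight n) p = real (perm_dist n \<alpha> \<beta>)"
    using geo by (simp add: geodesic_def arc)
  with triangle perm_dist_le_awalk_cost[OF walk]
  have "awalk_cost (edge_weight n) p = real (perm_dist n \<gamma> \<beta>)"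
    and "perm_dist n \<alpha> \<beta> = perm_dist n \<alpha> \<gamma> + perm_dist n \<gamma> \<beta>"
    by linarith+
  with arc walk show "\<exists>\<gamma>. e = (\<alpha>, \<gamma>) \<and> e \<in> parcs H \<and> geodesic \<gamma> p \<beta> \<and>
      perm_dist n \<alpha> \<beta> = perm_dist n \<alpha> \<gamma> + perm_dist n \<gamma> \<beta>"
    by (simp add: geodesic_def)
qed (auto simp: geodesic_def awalk_Cons_iff)

lemma geodesic_ex:
  assumes "\<mu> (edge_weight n) \<alpha> \<beta> = ereal (real (perm_dist n \<alpha> \<beta>))"
  shows "\<exists>p. geodesic \<alpha> p \<beta>"
proof -
  have "\<alpha> \<rightarrow>\<^sup>*\<^bsub>with_proj H\<^esub> \<beta>" using \<mu>_reach_conv[of "edge_weight n" \<alpha> \<beta>] assms by simp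
  then obtain p where "apath \<alpha> p \<beta>" "\<mu> (edge_weight n) \<alpha> \<beta> = awalk_cost (edge_weight n) p"
    using min_cost_awalk[of \<alpha> \<beta> "edge_weight n"] by (auto simp: edge_weight_def)
  then show ?thesis using assms awalkI_apath by (auto simp: geodesic_def)
qed

end

interpretation big_permutograph: subpermutograph n "big_permutograph n" for n
proof
  interpret big: pair_graph "big_permutograph n" by (rule pair_graph_big_permutograph)
  show "subgraph (with_proj (big_permutograph n)) (with_proj (big_permutograph n))"
    by (rule big.subgraph_refl)
qed

lemma big_permutograph_geodesic_ex:
  assumes "\<alpha> permutes {1..n}" and \<beta>: "\<beta> permutes {1..n}"
  shows "\<exists>p. big_permutograph.geodesic n \<alpha> p \<beta>"
  using assms(1)
proof (induction "perm_dist n \<alpha> \<beta>" arbitrary: \<alpha> rule: less_induct)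
  case less
  show ?case
  proof (cases "\<alpha> = \<beta>")
    case True
    with \<beta> have "big_permutograph.geodesic n \<alpha> [] \<beta>"
      by (simp add: big_permutograph.geodesic_Nil_iff)
    then show ?thesis ..
  next
    case False
    from permutes_neq_descent[OF less.prems \<beta> this] obtain k where
      k: "k \<in> {1..<n}" and descent: "perm_less \<beta> (\<alpha> (Suc k)) (\<alpha> k)" ..
    let ?\<gamma> = "\<alpha> \<circ> transpose k (Suc k)"
    have \<gamma>: "?\<gamma> permutes {1..n}"
      using k by (intro permutes_compose[OF permutes_swap_id less.prems]) auto
    note dist = perm_dist_comp_transpose[OF less.prems k descent]
    with less.hyps[OF _ \<gamma>] obtain p where "big_permutograph.geodesic n ?\<gamma> p \<beta>" by auto
    with dist less.prems \<gamma> have "big_permutograph.geodesic n \<alpha> ((\<alpha>, ?\<gamma>) # p) \<beta>"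
      by (simp add: big_permutograph.geodesic_Cons_iff perm_adjacent_transpose[OF less.prems k]
          perm_dist_transpose_self[OF less.prems k])
    then show ?thesis ..
  qed
qed

lemma big_permutograph_min_cost:
  assumes "\<alpha> permutes {1..n}" "\<beta> permutes {1..n}"
  shows "wf_digraph.\<mu> (with_proj (big_permutograph n)) (edge_weight n) \<alpha> \<beta> =
    ereal (real (perm_dist n \<alpha> \<beta>))"
proof (rule antisym[OF _ big_permutograph.perm_dist_le_min_cost])
  obtain p where "big_permutograph.geodesic n \<alpha> p \<beta>"
    using big_permutograph_geodesic_ex[OF assms] by blast
  then show "big_permutograph.\<mu> n (edge_weight n) \<alpha> \<beta> \<le> ereal (real (perm_dist n \<alpha> \<beta>))"
    using big_permutograph.min_cost_le_walk_cost unfolding big_permutograph.geodesic_def by metis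
qed

lemma subpermutograph_if_permutograph: "permutograph n H \<Longrightarrow> subpermutograph n H"
  by (simp add: permutograph_def subpermutograph_def)

lemma permutograph_min_cost:
  assumes "permutograph n H" "\<alpha> \<in> pverts H" "\<beta> \<in> pverts H"
  shows "wf_digraph.\<mu> (with_proj H) (edge_weight n) \<alpha> \<beta> = ereal (real (perm_dist n \<alpha> \<beta>))"
proof -
  have "wf_digraph.\<mu> (with_proj H) (edge_weight n) \<alpha> \<beta> =
      wf_digraph.\<mu> (with_proj (big_permutograph n)) (edge_weight n) \<alpha> \<beta>"
    using assms by (simp add: permutograph_def)
  also have "\<dots> = ereal (real (perm_dist n \<alpha> \<beta>))"
    using assms(2,3) subpermutograph.pverts_subset[OF subpermutograph_if_permutograph[OF assms(1)]]
    by (intro big_permutograph_min_cost) auto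
  finally show ?thesis .
qed

section \<open>Separation along geodesics\<close>

lemma separating_element_step:
  assumes \<alpha>: "\<alpha> permutes {1..n}" and \<gamma>: "\<gamma> permutes {1..n}"
    and adj: "pi_adjacent n \<pi> \<alpha> \<gamma>"
    and disjoint: "inversions n \<alpha> \<gamma> \<inter> inversions n \<gamma> \<beta> = {}"
    and mem: "a \<in> {1..n}" "c \<in> {1..n}" "u \<in> {1..n}"
    and same_block: "perm_block \<pi> \<alpha> a = perm_block \<pi> \<gamma> c"
    and u: "perm_le \<gamma> u c" "perm_le \<beta> b u"
  shows "\<exists>v\<in>{1..n}. perm_le \<alpha> v a \<and> perm_le \<beta> b v"
proof (cases "perm_le \<alpha> u a")
  case True
  with mem(3) u(2) show ?thesis by blast
next
  case False
  then have a_before_u: "perm_less \<alpha> a u" by (simp add: perm_le_def perm_less_def)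
  note partition = pi_adjacent_ordered_partition[OF adj]
  have "perm_block \<pi> \<alpha> a = perm_block \<pi> \<alpha> u"
  proof (rule antisym)
    have "perm_le \<alpha> a u" using a_before_u by (simp add: perm_le_def perm_less_def)
    then show "perm_block \<pi> \<alpha> a \<le> perm_block \<pi> \<alpha> u"
      by (rule perm_block_mono[OF partition \<alpha> mem(1,3)])
    show "perm_block \<pi> \<alpha> u \<le> perm_block \<pi> \<alpha> a"
      using perm_block_mono[OF partition \<gamma> mem(3,2) u(1)] same_block
      by (simp add: pi_adjacent_perm_block[OF \<gamma> adj])
  qed
  then have u_before_a: "perm_less \<gamma> u a"
    by (rule pi_adjacent_reverses[OF \<alpha> \<gamma> adj mem(1,3) _ a_before_u])
  with a_before_u have "{a, u} \<in> inversions n \<alpha> \<gamma>"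
    by (simp add: pair_in_inversions_iff[OF mem(1,3)])
  with disjoint have "{a, u} \<notin> inversions n \<gamma> \<beta>" by blast
  with u_before_a have "\<not> perm_less \<beta> a u" by (simp add: pair_in_inversions_iff[OF mem(1,3)])
  with u(2) have "perm_le \<beta> b a" by (simp add: perm_le_def perm_less_def)
  with mem(1) show ?thesis by (auto simp: perm_le_def)
qed

lemma (in subpermutograph) DPL_function_geodesic_separation:
  assumes F: "F \<in> pverts H \<rightarrow> {1..n}" and dpl: "DPL_function n (pverts H) F"
    and "geodesic \<alpha> p \<beta>"
  shows "\<exists>u\<in>{1..n}. perm_le \<alpha> u (F \<alpha>) \<and> perm_le \<beta> (F \<beta>) u"
  using assms(3)
proof (induction p arbitrary: \<alpha>)
  case Nil
  then show ?case using F by (auto simp: geodesic_Nil_iff perm_le_def)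
next
  case (Cons e p)
  then obtain \<gamma> where arc: "(\<alpha>, \<gamma>) \<in> parcs H" and geo: "geodesic \<gamma> p \<beta>"
    and additive: "perm_dist n \<alpha> \<beta> = perm_dist n \<alpha> \<gamma> + perm_dist n \<gamma> \<beta>"
    by (auto simp: geodesic_Cons_iff)
  have verts: "\<alpha> \<in> pverts H" "\<gamma> \<in> pverts H"
    using wellformed[of "(\<alpha>, \<gamma>)"] arc by auto
  then have perms: "\<alpha> permutes {1..n}" "\<gamma> permutes {1..n}"
    using pverts_subset by auto
  from arc_perm_adjacent[OF arc] obtain \<pi> where adj: "pi_adjacent n \<pi> \<alpha> \<gamma>"
    by (auto simp: perm_adjacent_def)
  have "perm_block \<pi> \<alpha> (F \<alpha>) = perm_block \<pi> \<gamma> (F \<gamma>)"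
    using dpl verts adj DPL_function_iff_perm_block[OF pverts_subset F] by blast
  moreover have "inversions n \<alpha> \<gamma> \<inter> inversions n \<gamma> \<beta> = {}"
    by (rule inversions_disjoint_if_perm_dist_additive[OF perms(2) additive])
  moreover obtain u where "u \<in> {1..n}" "perm_le \<gamma> u (F \<gamma>)" "perm_le \<beta> (F \<beta>) u"
    using Cons.IH[OF geo] by blast
  moreover have "F \<alpha> \<in> {1..n}" "F \<gamma> \<in> {1..n}" using F verts by auto
  ultimately show ?case
    using separating_element_step[OF perms adj] by blast
qed

theorem theorem2:
  fixes n :: nat
    and H :: "(nat \<Rightarrow> nat) pair_pre_digraph"
    and S :: "(nat \<Rightarrow> nat) set"
    and F :: "(nat \<Rightarrow> nat) \<Rightarrow> nat"
  assumes "1 \<le> n"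
    and "permutograph n H"
    and "S = pverts H"
    and "F \<in> S \<rightarrow> {1..n}"
  shows "DPL_function n S F \<longleftrightarrow> separation_property n S F"
proof
  interpret subpermutograph n H
    by (rule subpermutograph_if_permutograph[OF assms(2)])
  have "\<exists>p. geodesic \<alpha> p \<beta>" if "\<alpha> \<in> S" "\<beta> \<in> S" for \<alpha> \<beta>
    using geodesic_ex permutograph_min_cost[OF assms(2)] assms(3) that by blast
  then show "separation_property n S F" if "DPL_function n S F"
    using DPL_function_geodesic_separation assms(3,4) that
    unfolding separation_property_def by blast
  show "DPL_function n S F" if "separation_property n S F"
    using separation_property_imp_DPL_function pverts_subset assms(3,4) that by blast
qed

end
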